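(* For each weight vector $w\in\mathbb{R}^T$, let $g^*(w)\in\mathbb{R}^T$ be the unique minimizer over $g\in\mathbb{R}^T$ of the weighted DeePC objective $J(g;w)$ defined in the context, and write $g^*=g^*(\mathbf{1})$, where $\mathbf{1}$ is the all-ones vector, and $H=M+\lambda_g I_T$. Let $$f(g;w)=\|Y_fWg-y_{\mathrm{ref}}\|_Q^2+\|U_fWg\|_R^2,\qquad W=\operatorname{diag}(w),$$ be the control cost. Then for every $j\in\{1,\dots,T\}$, the sensitivity of trajectory segment $z_j$, defined as the total derivative of the control cost with respect to the segment weight $w_j$ at the baseline $w=\mathbf{1}$, is $$\mathcal{S}(z_j):=\frac{d f(g^*(w);w)}{d w_j}\bigg|_{w=\mathbf{1}}=2\lambda_g\,g_j^*\,p_j,$$ where $p=H^{-1}v$ and $v=\nabla_g f(g^*;\mathbf{1})=2\left(Y_f^\top Q(Y_fg^*-y_{\mathrm{ref}})+U_f^\top RU_fg^*\right)$, and $g_j^*,p_j$ denote the $j$-th entries of $g^*,p$.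
   Context: Data. Let $u_1,\dots,u_{N_d}\in\mathbb{R}^m$ and $y_1,\dots,y_{N_d}\in\mathbb{R}^p$ be recorded input and output sequences (here the integer $p$ is the output dimension; in the claim $p$ denotes a vector in $\mathbb{R}^T$). Let $T_{\mathrm{ini}}, N$ be positive integers, $L=T_{\mathrm{ini}}+N$, and $T=N_d-L+1\ge 1$. The depth-$L$ Hankel matrix $\mathscr{H}_L(u)\in\mathbb{R}^{Lm\times T}$ has $j$-th column $(u_j^\top,u_{j+1}^\top,\dots,u_{j+L-1}^\top)^\top$; $\mathscr{H}_L(y)\in\mathbb{R}^{Lp\times T}$ is defined analogously. They are partitioned as $\mathscr{H}_L(u)=\begin{bmatrix} U_p \\ U_f \end{bmatrix}$, $\mathscr{H}_L(y)=\begin{bmatrix} Y_p \\ Y_f \end{bmatrix}$ with $U_p\in\mathbb{R}^{T_{\mathrm{ini}}m\times T}$, $U_f\in\mathbb{R}^{Nm\times T}$, $Y_p\in\mathbb{R}^{T_{\mathrm{ini}}p\times T}$, $Y_f\in\mathbb{R}^{Np\times T}$. The trajectory segment $z_j$ is the stacked vector of the $j$-th columns of $U_p,U_f,Y_p,Y_f$. Parameters. $u_{\mathrm{ini}}\in\mathbb{R}^{T_{\mathrm{ini}}m}$, $y_{\mathrm{ini}}\in\mathbb{R}^{T_{\mathrm{ini}}p}$, $y_{\mathrm{ref}}\in\mathbb{R}^{Np}$ are given vectors; $Q\in\mathbb{R}^{Np\times Np}$ and $R\in\mathbb{R}^{Nm\times Nm}$ are symmetric positive definite; $\lambda_g,\lambda_y,\lambda_u>0$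 are scalars. Notation: $\|v\|_P^2=v^\top P v$, and $\|\cdot\|$ on vectors is the Euclidean norm. Weighted DeePC objective. For $w\in\mathbb{R}^T$, $W=\operatorname{diag}(w)$, and $g\in\mathbb{R}^T$, $$J(g;w)=\|Y_fWg-y_{\mathrm{ref}}\|_Q^2+\|U_fWg\|_R^2+\lambda_g\|g\|^2+\lambda_y\|Y_pWg-y_{\mathrm{ini}}\|^2+\lambda_u\|U_pWg-u_{\mathrm{ini}}\|^2 .$$ Define $$M=Y_f^\top QY_f+U_f^\top RU_f+\lambda_yY_p^\top Y_p+\lambda_uU_p^\top U_p\in\mathbb{R}^{T\times T},\qquad b=Y_f^\top Qy_{\mathrm{ref}}+\lambda_yY_p^\top y_{\mathrm{ini}}+\lambda_uU_p^\top u_{\mathrm{ini}}\in\mathbb{R}^T .$$ The minimizer $g^*(w)$ of $J(\cdot;w)$ is characterized by $(WMW+\lambda_gI_T)\,g^*(w)=Wb$. *)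

theory Defs
  imports "HOL-Analysis.Analysis"
begin

text \<open>
  All dimensions are cardinalities of finite linearly ordered index types: \<open>'ti\<close> and \<open>'n\<close>
  index the past and the future time steps (so \<open>CARD('ti)\<close> is the initial horizon,
  \<open>CARD('n)\<close> the prediction horizon, and \<open>'ti + 'n\<close> indexes the full depth), and
  \<open>'t\<close> indexes the trajectory segments.  A stacked vector of \<open>k\<close> blocks in \<open>\<real>\<^sup>m\<close> is a vector
  indexed by pairs (block, component).
\<close>

text \<open>
  The syntax \<open>real^'n\<close> pins the sort of \<open>'n\<close> to \<open>finite\<close>; these abbreviations leave room for \<open>linorder\<close>.
\<close>

type_synonym 'n rvec = "(real, 'n) vec"
type_synonym ('r, 'c) rmat = "((real, 'c) vec, 'r) vec"

text \<open>Zero-based position of an index in its finite linear order.\<close>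

definition pos :: "'a::{finite,linorder} \<Rightarrow> nat" where
  "pos k = card {l. l < k}"

fun depth_pos :: "'ti::{finite,linorder} + 'n::{finite,linorder} \<Rightarrow> nat" where
  "depth_pos (Inl k) = pos k"
| "depth_pos (Inr k) = CARD('ti) + pos k"

text \<open>Lists are zero-based: the sample \<open>u\<^sub>k\<close> of the recorded sequence is \<open>u ! (k - 1)\<close>.\<close>

definition hankel ::
  "(real^'m) list \<Rightarrow> real^'t::{finite,linorder}^(('ti::{finite,linorder} + 'n::{finite,linorder}) \<times> 'm)"
  where "hankel u = (\<chi> r c. (u ! (pos c + depth_pos (fst r))) $ snd r)"

definition past_rows :: "real^'t^(('ti::finite + 'n::finite) \<times> 'm::finite) \<Rightarrow> real^'t^('ti \<times> 'm)" where
  "past_rows A = (\<chi> r. A $ (Inl (fst r), snd r))"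

definition future_rows :: "real^'t^(('ti::finite + 'n::finite) \<times> 'm::finite) \<Rightarrow> real^'t^('n \<times> 'm)" where
  "future_rows A = (\<chi> r. A $ (Inr (fst r), snd r))"

definition sym_pos_def :: "real^'n^'n \<Rightarrow> bool" where
  "sym_pos_def P \<longleftrightarrow> transpose P = P \<and> (\<forall>x. x \<noteq> 0 \<longrightarrow> x \<bullet> (P *v x) > 0)"

definition wnorm_sq :: "real^'n^'n \<Rightarrow> real^'n \<Rightarrow> real" where
  "wnorm_sq P v = v \<bullet> (P *v v)"

definition diag :: "real^'n \<Rightarrow> real^'n^'n" where
  "diag w = (\<chi> i j. if i = j then w $ i else 0)"

definition control_cost ::
  "real^'y^'y \<Rightarrow> real^'u^'u \<Rightarrow> real^'t^'y \<Rightarrow> real^'t^'u \<Rightarrow> real^'y \<Rightarrow> real^'t \<Rightarrow> real^'t \<Rightarrow> real"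
  where
  "control_cost Q R Yf Uf yref g w =
     wnorm_sq Q (Yf *v (diag w *v g) - yref) + wnorm_sq R (Uf *v (diag w *v g))"

definition deepc_objective ::
  "real^'yf^'yf \<Rightarrow> real^'uf^'uf \<Rightarrow> real \<Rightarrow> real \<Rightarrow> real \<Rightarrow>
   real^'t^'up \<Rightarrow> real^'t^'uf \<Rightarrow> real^'t^'yp \<Rightarrow> real^'t^'yf \<Rightarrow>
   real^'up \<Rightarrow> real^'yp \<Rightarrow> real^'yf \<Rightarrow> real^'t \<Rightarrow> real^'t \<Rightarrow> real"
  where
  "deepc_objective Q R lg ly lu Up Uf Yp Yf uini yini yref g w =
     wnorm_sq Q (Yf *v (diag w *v g) - yref) + wnorm_sq R (Uf *v (diag w *v g))
     + lg * (norm g)\<^sup>2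
     + ly * (norm (Yp *v (diag w *v g) - yini))\<^sup>2
     + lu * (norm (Up *v (diag w *v g) - uini))\<^sup>2"

end

theory Submission
  imports Defs
begin

text \<open>
  With \<open>x = W g\<close>, the normal equation of the weighted problem reads
  \<open>\<lambda>\<^sub>g x = W\<^sup>2 (b - M x)\<close>.  If only the \<open>j\<close>-th weight \<open>s\<close> differs from 1, this is
  \<open>H x = b + (s\<^sup>2 - 1) r e\<^sub>j\<close>, where \<open>r\<close> is the \<open>j\<close>-th entry of the residual \<open>b - M x\<close>.  Hence \<open>x\<close> moves along the
  fixed line \<open>g\<^sup>* + \<rho> H\<^sup>-\<^sup>1 e\<^sub>j\<close>, and taking the \<open>j\<close>-th entry gives \<open>\<rho>\<close> as an explicit rational
  function of \<open>s\<close> with \<open>\<rho>'(1) = 2 \<lambda>\<^sub>g g\<^sup>*\<^sub>j\<close>.  The control cost is quadratic along this line with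
  slope \<open>v \<bullet> H\<^sup>-\<^sup>1 e\<^sub>j = p\<^sub>j\<close>.  No differentiability of \<open>w \<mapsto> g\<^sup>*(w)\<close> has to be shown.
\<close>

section \<open>Positive definite matrices and quadratic functions\<close>

lemma inner_matrix_vector_sym:
  fixes A :: "real^'n^'n"
  assumes "transpose A = A"
  shows "x \<bullet> (A *v y) = (A *v x) \<bullet> y"
  using assms by (metis dot_lmul_matrix transpose_matrix_vector)

lemma inner_transpose_mult:
  fixes B :: "real^'n^'k"
  shows "x \<bullet> (transpose B *v y) = (B *v x) \<bullet> y"
  by (metis dot_lmul_matrix inner_commute transpose_matrix_vector)

lemma transpose_add: "transpose (A + B) = transpose A + transpose B"
  by (simp add: transpose_def vec_eq_iff)

lemma sym_pos_def_imp_invertible: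
  assumes "sym_pos_def A"
  shows "invertible A"
proof -
  have "x = 0" if "A *v x = 0" for x
    using assms that unfolding sym_pos_def_def by (metis inner_zero_right less_irrefl)
  then show ?thesis
    by (meson invertible_left_inverse matrix_left_invertible_ker)
qed

lemma sym_pos_def_imp_wnorm_sq_nonneg:
  assumes "sym_pos_def P"
  shows "wnorm_sq P x \<ge> 0"
  using assms unfolding sym_pos_def_def wnorm_sq_def
  by (cases "x = 0") (auto intro: less_imp_le)

text \<open>The regularizer alone supplies strictness, so rank-deficient data and zero weights are
  covered.\<close>

lemma sym_pos_def_add_scaled_mat_1:
  fixes A :: "real^'n^'n"
  assumes "transpose A = A" and "\<And>x. x \<bullet> (A *v x) \<ge> 0" and "c > 0"
  shows "sym_pos_def (A + c *\<^sub>R mat 1)"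
  unfolding sym_pos_def_def
proof (intro conjI allI impI)
  show "transpose (A + c *\<^sub>R mat 1) = A + c *\<^sub>R mat 1"
    using assms(1) by (simp add: transpose_add transpose_scalar)
next
  fix x :: "real^'n"
  assume "x \<noteq> 0"
  then have "c * (x \<bullet> x) > 0"
    using assms(3) by simp
  with assms(2)[of x] show "x \<bullet> ((A + c *\<^sub>R mat 1) *v x) > 0"
    by (simp add: matrix_vector_mult_add_rdistrib scaleR_matrix_vector_assoc[symmetric] inner_add_right)
qed

lemma matrix_inv_vec_cancel:
  fixes A :: "real^'n^'n"
  assumes "invertible A"
  shows "A *v (matrix_inv A *v x) = x" and "matrix_inv A *v (A *v x) = x"
  \<comment> \<open>\<open>matrix_inv\<close> is a Hilbert choice, so both laws come from the
    existence of a two-sided inverse.\<close>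
  using someI_ex[OF assms[unfolded invertible_def]]
  by (simp_all add: matrix_inv_def matrix_vector_mul_assoc)

text \<open>Complete the square about the solution \<open>g0\<close> of \<open>A *v g0 = c\<close>:
  the value at \<open>g\<close> exceeds that at \<open>g0\<close> by the form of \<open>A\<close> at
  \<open>g - g0\<close>, which is positive unless \<open>g = g0\<close>.\<close>

lemma is_arg_min_quadratic_iff:
  fixes A :: "real^'n^'n"
  assumes A: "sym_pos_def A"
  shows "is_arg_min (\<lambda>g. g \<bullet> (A *v g) - 2 * (g \<bullet> c) + k) (\<lambda>_. True) g \<longleftrightarrow> A *v g = c"
proof -
  let ?q = "\<lambda>g. g \<bullet> (A *v g) - 2 * (g \<bullet> c) + k"
  have inv: "invertible A"
    using A by (rule sym_pos_def_imp_invertible)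
  define g0 where "g0 = matrix_inv A *v c"
  have g0: "A *v g0 = c"
    using inv by (simp add: g0_def matrix_inv_vec_cancel)
  have q: "?q g = ?q g0 + (g - g0) \<bullet> (A *v (g - g0))" for g
  proof -
    have "g0 \<bullet> (A *v g) = g \<bullet> c"
      using A g0 by (simp add: inner_matrix_vector_sym sym_pos_def_def inner_commute)
    then show ?thesis
      by (simp add: g0 matrix_vector_mult_diff_distrib inner_diff_left inner_diff_right)
  qed
  have pos: "(g - g0) \<bullet> (A *v (g - g0)) > 0" if "g \<noteq> g0" for g
    using A that by (simp add: sym_pos_def_def)
  have "is_arg_min ?q (\<lambda>_. True) g \<longleftrightarrow> g = g0"
    unfolding is_arg_min_def using q pos by (metis add.right_neutral add_less_cancel_left less_asym)
  also have "\<dots> \<longleftrightarrow> A *v g = c"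
    using g0 inv by (metis matrix_inv_vec_cancel(2))
  finally show ?thesis .
qed

text \<open>Symmetry of \<open>P\<close> merges the two cross terms. This exact expansion serves
  both the normal form of the objective and the control cost along a line.\<close>

lemma wnorm_sq_affine_add:
  assumes "transpose P = P"
  shows "wnorm_sq P (B *v (x + d) - c)
    = wnorm_sq P (B *v x - c) + 2 * (d \<bullet> (transpose B *v (P *v (B *v x - c)))) + wnorm_sq P (B *v d)"
proof -
  have *: "B *v (x + d) - c = (B *v x - c) + B *v d"
    by (simp add: matrix_vector_right_distrib)
  have "(B *v x - c) \<bullet> (P *v (B *v d)) = (B *v d) \<bullet> (P *v (B *v x - c))"
    using assms by (simp add: inner_matrix_vector_sym inner_commute)
  then show ?thesis
    unfolding * wnorm_sq_def
    by (simp add: matrix_vector_right_distrib inner_add_left inner_add_right inner_transpose_mult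
        del: transpose_matrix_vector)
qed

lemma wnorm_sq_affine:
  assumes "transpose P = P"
  shows "wnorm_sq P (B *v x - c)
    = x \<bullet> ((transpose B ** P ** B) *v x) - 2 * (x \<bullet> (transpose B *v (P *v c))) + wnorm_sq P c"
  \<comment> \<open>Expansion about the base point 0 with increment \<open>x\<close>.\<close>
  using wnorm_sq_affine_add[OF assms, of B 0 x c]
  by (simp add: wnorm_sq_def matrix_vector_mul_assoc[symmetric] inner_transpose_mult
      vec.neg inner_minus_right del: transpose_matrix_vector)

lemma has_derivative_wnorm_sq_affine:
  assumes "transpose P = P"
  shows "((\<lambda>x. wnorm_sq P (B *v x - c)) has_derivative
    (\<lambda>h. h \<bullet> (2 *\<^sub>R (transpose B *v (P *v (B *v x - c)))))) (at x)"
proof -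
  have "((\<lambda>x. (B *v x - c) \<bullet> (P *v (B *v x - c))) has_derivative
    (\<lambda>h. (B *v x - c) \<bullet> (P *v (B *v h)) + (B *v h) \<bullet> (P *v (B *v x - c)))) (at x)"
    by (auto intro!: derivative_eq_intros bounded_linear.has_derivative[OF matrix_vector_mul_bounded_linear])
  moreover have "(B *v x - c) \<bullet> (P *v (B *v h)) = (B *v h) \<bullet> (P *v (B *v x - c))" for h
    using inner_matrix_vector_sym[OF assms] inner_commute by metis
  ultimately show ?thesis
    by (simp add: wnorm_sq_def inner_transpose_mult del: transpose_matrix_vector)
qed

section \<open>Diagonal weights and the control cost\<close>

lemma diag_mult_nth: "(diag w *v x) $ i = w $ i * x $ i"
  by (simp add: diag_def matrix_vector_mult_def if_distrib[where f="\<lambda>a. a * _"] cong: if_cong)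

lemma diag_1: "diag 1 = mat 1"
  by (simp add: diag_def mat_def vec_eq_iff)

lemma transpose_diag: "transpose (diag w) = diag w"
  by (auto simp: diag_def transpose_def vec_eq_iff)

text \<open>Lets \<open>wnorm_sq_affine\<close> treat the Euclidean residuals like the
  \<open>Q\<close> and \<open>R\<close> terms.\<close>

lemma norm_sq_eq_wnorm_sq: "(norm x)\<^sup>2 = wnorm_sq (mat 1) x"
  by (simp add: wnorm_sq_def power2_norm_eq_inner)

lemma gderiv_control_cost:
  assumes Q: "sym_pos_def Q" and R: "sym_pos_def R"
  shows "GDERIV (\<lambda>g. control_cost Q R Yf Uf yref g 1) g :>
    2 *\<^sub>R (transpose Yf *v (Q *v (Yf *v g - yref)) + transpose Uf *v (R *v (Uf *v g)))"
proof -
  have tr: "transpose Q = Q" "transpose R = R"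
    using Q R by (auto simp: sym_pos_def_def)
  show ?thesis
    unfolding gderiv_def control_cost_def diag_1 matrix_vector_mul_lid
    using has_derivative_add[OF has_derivative_wnorm_sq_affine[OF tr(1), of Yf yref g]
        has_derivative_wnorm_sq_affine[OF tr(2), of Uf 0 g]]
    by (simp add: inner_add_right algebra_simps)
qed

lemma control_cost_line:
  assumes Q: "sym_pos_def Q" and R: "sym_pos_def R"
  shows "control_cost Q R Yf Uf yref (g + a *\<^sub>R h) 1 = control_cost Q R Yf Uf yref g 1
    + a * (h \<bullet> (2 *\<^sub>R (transpose Yf *v (Q *v (Yf *v g - yref)) + transpose Uf *v (R *v (Uf *v g)))))
    + a\<^sup>2 * (wnorm_sq Q (Yf *v h) + wnorm_sq R (Uf *v h))"
proof -
  have tr: "transpose Q = Q" "transpose R = R"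
    using Q R by (auto simp: sym_pos_def_def)
  show ?thesis
    using wnorm_sq_affine_add[OF tr(1), of Yf g "a *\<^sub>R h" yref]
      wnorm_sq_affine_add[OF tr(2), of Uf g "a *\<^sub>R h" 0]
    by (simp add: control_cost_def diag_1 wnorm_sq_def matrix_vector_mult_scaleR inner_add_right
        power2_eq_square algebra_simps)
qed

section \<open>The regularized problem and its normal equation\<close>

context
  fixes Q :: "real^'yf^'yf" and R :: "real^'uf^'uf" and lg ly lu :: real
    and Up :: "real^'t^'up" and Uf :: "real^'t^'uf" and Yp :: "real^'t^'yp" and Yf :: "real^'t^'yf"
    and uini :: "real^'up" and yini :: "real^'yp" and yref :: "real^'yf"
    and M H :: "real^'t^'t" and b :: "real^'t"
  assumes Q: "sym_pos_def Q" and R: "sym_pos_def R"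
    and lg: "lg > 0" and ly: "ly > 0" and lu: "lu > 0"
  defines "M \<equiv> transpose Yf ** Q ** Yf + transpose Uf ** R ** Uf
      + ly *\<^sub>R (transpose Yp ** Yp) + lu *\<^sub>R (transpose Up ** Up)"
    and "b \<equiv> transpose Yf *v (Q *v yref) + ly *\<^sub>R (transpose Yp *v yini) + lu *\<^sub>R (transpose Up *v uini)"
    and "H \<equiv> M + lg *\<^sub>R mat 1"
begin

lemma transpose_gram: "transpose M = M"
  using Q R unfolding M_def sym_pos_def_def
  by (simp add: transpose_add transpose_scalar matrix_transpose_mul matrix_mul_assoc)

lemma gram_nonneg: "x \<bullet> (M *v x) \<ge> 0"
proof -
  have "x \<bullet> (M *v x) = wnorm_sq Q (Yf *v x) + wnorm_sq R (Uf *v x)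
      + ly * (norm (Yp *v x))\<^sup>2 + lu * (norm (Up *v x))\<^sup>2"
    unfolding M_def
    by (simp add: wnorm_sq_def power2_norm_eq_inner matrix_vector_mult_add_rdistrib inner_add_right
        scaleR_matrix_vector_assoc[symmetric] matrix_vector_mul_assoc[symmetric] inner_transpose_mult
        del: transpose_matrix_vector)
  then show ?thesis
    using ly lu sym_pos_def_imp_wnorm_sq_nonneg[OF Q] sym_pos_def_imp_wnorm_sq_nonneg[OF R]
    by simp
qed

lemma sym_pos_def_weighted: "sym_pos_def (diag w ** M ** diag w + lg *\<^sub>R mat 1)"
proof (rule sym_pos_def_add_scaled_mat_1[OF _ _ lg])
  show "transpose (diag w ** M ** diag w) = diag w ** M ** diag w"
    by (simp add: matrix_transpose_mul transpose_diag transpose_gram matrix_mul_assoc)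
  show "x \<bullet> ((diag w ** M ** diag w) *v x) \<ge> 0" for x
    using gram_nonneg[of "diag w *v x"] inner_transpose_mult[of x "diag w"]
    by (simp add: transpose_diag matrix_vector_mul_assoc[symmetric])
qed

lemma sym_pos_def_hessian: "sym_pos_def H"
  using sym_pos_def_weighted[of 1] by (simp add: diag_1 H_def)

text \<open>Minimizers ignore the constant term, so it is hidden by the existential.\<close>

lemma deepc_objective_quadratic:
  "\<exists>k. \<forall>g. deepc_objective Q R lg ly lu Up Uf Yp Yf uini yini yref g w
    = g \<bullet> ((diag w ** M ** diag w + lg *\<^sub>R mat 1) *v g) - 2 * (g \<bullet> (diag w *v b)) + k"
proof (intro exI allI)
  fix g
  define x where "x = diag w *v g"
  have tr: "transpose Q = Q" "transpose R = R"
    using Q R by (auto simp: sym_pos_def_def)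
  have Rterm: "wnorm_sq R (Uf *v x) = x \<bullet> ((transpose Uf ** R ** Uf) *v x)"
    using wnorm_sq_affine[OF tr(2), of Uf x 0] by (simp add: wnorm_sq_def)
  have "g \<bullet> ((diag w ** M ** diag w + lg *\<^sub>R mat 1) *v g) = x \<bullet> (M *v x) + lg * (norm g)\<^sup>2"
    using inner_transpose_mult[of g "diag w" "M *v x"]
    by (simp add: x_def transpose_diag matrix_vector_mult_add_rdistrib inner_add_right
        scaleR_matrix_vector_assoc[symmetric] matrix_vector_mul_assoc[symmetric] power2_norm_eq_inner)
  moreover have "g \<bullet> (diag w *v b) = x \<bullet> b"
    using inner_transpose_mult[of g "diag w" b] by (simp add: x_def transpose_diag)
  ultimately show "deepc_objective Q R lg ly lu Up Uf Yp Yf uini yini yref g w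
    = g \<bullet> ((diag w ** M ** diag w + lg *\<^sub>R mat 1) *v g) - 2 * (g \<bullet> (diag w *v b))
      + (wnorm_sq Q yref + ly * wnorm_sq (mat 1) yini + lu * wnorm_sq (mat 1) uini)"
    \<comment> \<open>The pattern \<open>_ - _\<close> selects the two residual norms and leaves
      \<open>(norm g)\<^sup>2\<close> alone.\<close>
    unfolding deepc_objective_def x_def[symmetric] norm_sq_eq_wnorm_sq[of "_ - _"]
      wnorm_sq_affine[OF tr(1)] wnorm_sq_affine[OF transpose_mat] Rterm
    by (simp add: M_def b_def matrix_vector_mult_add_rdistrib inner_add_right
        scaleR_matrix_vector_assoc[symmetric] algebra_simps)
qed

lemma is_arg_min_deepc_iff:
  "is_arg_min (\<lambda>g. deepc_objective Q R lg ly lu Up Uf Yp Yf uini yini yref g w) (\<lambda>_. True) g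
    \<longleftrightarrow> (diag w ** M ** diag w + lg *\<^sub>R mat 1) *v g = diag w *v b"
proof -
  from deepc_objective_quadratic[of w] obtain k where
    "\<And>g. deepc_objective Q R lg ly lu Up Uf Yp Yf uini yini yref g w
      = g \<bullet> ((diag w ** M ** diag w + lg *\<^sub>R mat 1) *v g) - 2 * (g \<bullet> (diag w *v b)) + k"
    by blast
  then show ?thesis
    by (simp only: is_arg_min_quadratic_iff[OF sym_pos_def_weighted])
qed

lemma ex1_is_arg_min_deepc:
  "\<exists>!g. is_arg_min (\<lambda>g. deepc_objective Q R lg ly lu Up Uf Yp Yf uini yini yref g w) (\<lambda>_. True) g"
proof -
  let ?A = "diag w ** M ** diag w + lg *\<^sub>R mat 1"
  have inv: "invertible ?A"
    using sym_pos_def_weighted by (rule sym_pos_def_imp_invertible)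
  show ?thesis
    unfolding is_arg_min_deepc_iff
  proof (rule ex1I)
    show "?A *v (matrix_inv ?A *v (diag w *v b)) = diag w *v b"
      using inv by (rule matrix_inv_vec_cancel)
    show "g = matrix_inv ?A *v (diag w *v b)" if "?A *v g = diag w *v b" for g
      using matrix_inv_vec_cancel(2)[OF inv, of g] that by simp
  qed
qed

section \<open>Sensitivity with respect to one weight\<close>

lemma weighted_minimizer_line:
  fixes j :: 't and s :: real
  defines "w \<equiv> (\<chi> i. if i = j then s else 1)"
    and "h \<equiv> matrix_inv H *v axis j 1"
  assumes g: "(diag w ** M ** diag w + lg *\<^sub>R mat 1) *v g = diag w *v b"
    and g1: "H *v g1 = b"
    and nz: "1 + (s\<^sup>2 - 1) * (M *v h) $ j \<noteq> 0"
  shows "diag w *v g = g1 + ((s\<^sup>2 - 1) * (lg * g1 $ j) / (1 + (s\<^sup>2 - 1) * (M *v h) $ j)) *\<^sub>R h"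
proof -
  define x where "x = diag w *v g"
  define r where "r = b - M *v x"
  have inv: "invertible H"
    using sym_pos_def_hessian by (rule sym_pos_def_imp_invertible)
  have Hh: "H *v h = axis j 1"
    using inv by (simp add: h_def matrix_inv_vec_cancel)
  have H: "H *v z = M *v z + lg *\<^sub>R z" for z
    by (simp add: H_def matrix_vector_mult_add_rdistrib scaleR_matrix_vector_assoc[symmetric])
  have "diag w *v (M *v x) + lg *\<^sub>R g = diag w *v b"
    using g by (simp add: x_def matrix_vector_mult_add_rdistrib
        scaleR_matrix_vector_assoc[symmetric] matrix_vector_mul_assoc[symmetric])
  then have "lg *\<^sub>R g = diag w *v r"
    by (simp add: r_def matrix_vector_mult_diff_distrib algebra_simps)
  then have lgg: "lg * g $ i = w $ i * r $ i" for i
    by (metis diag_mult_nth real_scaleR_def vector_scaleR_component)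
  \<comment> \<open>Multiplying by \<open>w $ i\<close> once more turns \<open>g\<close> into
    \<open>x\<close>. Nothing is divided by a weight, so \<open>s = 0\<close> is no
    exception.\<close>
  have "lg * x $ i = (w $ i)\<^sup>2 * r $ i" for i
    using lgg[of i] by (simp add: x_def diag_mult_nth power2_eq_square)
  then have "lg *\<^sub>R x - r = ((s\<^sup>2 - 1) * r $ j) *\<^sub>R axis j 1"
    by (auto simp: vec_eq_iff w_def axis_def algebra_simps)
  \<comment> \<open>The left side of the previous equation is \<open>H *v x - b\<close>, while
    \<open>H *v g1 = b\<close> and \<open>H *v h = axis j 1\<close>.\<close>
  then have "H *v x = H *v (g1 + ((s\<^sup>2 - 1) * r $ j) *\<^sub>R h)"
    by (simp add: H[of x] matrix_vector_right_distrib matrix_vector_mult_scaleR Hh g1 r_def algebra_simps)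
  then have x: "x = g1 + ((s\<^sup>2 - 1) * r $ j) *\<^sub>R h"
    using inv by (metis matrix_inv_vec_cancel(2))
  have "M *v x = M *v g1 + ((s\<^sup>2 - 1) * r $ j) *\<^sub>R (M *v h)"
    by (subst x) (simp add: matrix_vector_right_distrib matrix_vector_mult_scaleR)
  \<comment> \<open>The baseline residual is proportional to \<open>g1\<close>; this is the source
    of the factor \<open>lg * g1 $ j\<close>.\<close>
  moreover have "b - M *v g1 = lg *\<^sub>R g1"
    using g1 H[of g1] by (simp add: algebra_simps)
  ultimately have "r = lg *\<^sub>R g1 - ((s\<^sup>2 - 1) * r $ j) *\<^sub>R (M *v h)"
    by (simp add: r_def algebra_simps)
  \<comment> \<open>The coefficient of \<open>h\<close> still contains \<open>r $ j\<close>, which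
    depends on \<open>x\<close>. The \<open>j\<close>-th entry is a scalar linear equation for it,
    solvable by \<open>nz\<close>.\<close>
  then have "r $ j = lg * g1 $ j - (s\<^sup>2 - 1) * r $ j * (M *v h) $ j"
    by (metis real_scaleR_def vector_minus_component vector_scaleR_component)
  then have "r $ j = lg * g1 $ j / (1 + (s\<^sup>2 - 1) * (M *v h) $ j)"
    using nz by (simp add: field_simps)
  with x show ?thesis
    by (simp add: x_def)
qed

lemma control_cost_sensitivity:
  fixes gmin :: "real^'t \<Rightarrow> real^'t" and j :: 't
  assumes gmin: "\<And>w. (diag w ** M ** diag w + lg *\<^sub>R mat 1) *v gmin w = diag w *v b"
  defines "v \<equiv> 2 *\<^sub>R (transpose Yf *v (Q *v (Yf *v gmin 1 - yref)) + transpose Uf *v (R *v (Uf *v gmin 1)))"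
  shows "((\<lambda>s. let w = (\<chi> i. if i = j then s else 1) in control_cost Q R Yf Uf yref (gmin w) w)
    has_real_derivative 2 * lg * gmin 1 $ j * (matrix_inv H *v v) $ j) (at 1)"
proof -
  define h where "h = matrix_inv H *v axis j 1"
  define \<mu> where "\<mu> = (M *v h) $ j"
  define a where "a = lg * gmin 1 $ j"
  define \<rho> where "\<rho> = (\<lambda>s::real. (s\<^sup>2 - 1) * a / (1 + (s\<^sup>2 - 1) * \<mu>))"
  define c where "c = wnorm_sq Q (Yf *v h) + wnorm_sq R (Uf *v h)"
  define F where "F = (\<lambda>s. let w = (\<chi> i. if i = j then s else 1) in control_cost Q R Yf Uf yref (gmin w) w)"
  have inv: "invertible H"
    using sym_pos_def_hessian by (rule sym_pos_def_imp_invertible)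
  have g1: "H *v gmin 1 = b"
    using gmin[of 1] by (simp add: diag_1 H_def)
  \<comment> \<open>Symmetry of \<open>H\<close> moves the inverse from the axis vector onto
    \<open>v\<close>.\<close>
  have hv: "h \<bullet> v = (matrix_inv H *v v) $ j"
  proof -
    have "h \<bullet> v = h \<bullet> (H *v (matrix_inv H *v v))"
      using inv by (simp add: matrix_inv_vec_cancel)
    also have "\<dots> = (H *v h) \<bullet> (matrix_inv H *v v)"
      using sym_pos_def_hessian by (simp add: inner_matrix_vector_sym sym_pos_def_def)
    also have "H *v h = axis j 1"
      using inv by (simp add: h_def matrix_inv_vec_cancel)
    finally show ?thesis
      by (simp add: inner_axis')
  qed
  have line: "control_cost Q R Yf Uf yref (gmin 1) 1 + \<rho> s * (h \<bullet> v) + (\<rho> s)\<^sup>2 * c = F s"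
    if "1 + (s\<^sup>2 - 1) * \<mu> \<noteq> 0" for s
  proof -
    define w :: "real^'t" where "w = (\<chi> i. if i = j then s else 1)"
    have "diag w *v gmin w = gmin 1 + \<rho> s *\<^sub>R h"
      using weighted_minimizer_line[OF gmin[of w, unfolded w_def] g1] that
      by (simp add: w_def h_def \<rho>_def \<mu>_def a_def)
    \<comment> \<open>The control cost sees \<open>g\<close> and \<open>w\<close> only through
      \<open>diag w *v g\<close>, so the weighted cost is the unweighted cost at that
      product.\<close>
    then have "F s = control_cost Q R Yf Uf yref (gmin 1 + \<rho> s *\<^sub>R h) 1"
      by (simp add: F_def w_def[symmetric] control_cost_def diag_1)
    then show ?thesis
      by (simp add: control_cost_line[OF Q R] c_def v_def)
  qed
  \<comment> \<open>At 1 the numerator vanishes and the denominator is 1, so only the slope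
    \<open>2 * a\<close> of the numerator survives.\<close>
  have "(\<rho> has_real_derivative 2 * a) (at 1)"
    unfolding \<rho>_def by (auto intro!: derivative_eq_intros)
  \<comment> \<open>Since \<open>\<rho> 1 = 0\<close>, the quadratic term has derivative 0.\<close>
  then have "((\<lambda>s. control_cost Q R Yf Uf yref (gmin 1) 1 + \<rho> s * (h \<bullet> v) + (\<rho> s)\<^sup>2 * c)
    has_real_derivative 2 * a * (h \<bullet> v)) (at 1)"
    by (auto intro!: derivative_eq_intros simp: \<rho>_def)
  \<comment> \<open>The formula for \<open>F\<close> holds on this open set, which contains 1, so
    the derivative carries over.\<close>
  moreover have "open {s::real. 1 + (s\<^sup>2 - 1) * \<mu> \<noteq> 0}"
    by (intro open_Collect_neq continuous_intros)
  ultimately have "(F has_real_derivative 2 * a * (h \<bullet> v)) (at 1)"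
    by (rule has_field_derivative_transform_within_open) (simp_all add: line)
  then show ?thesis
    by (simp add: F_def hv a_def mult.assoc)
qed

end

text \<open>The first three conjuncts certify the objects in the last: \<open>THE\<close> picks a
  genuine minimizer, \<open>matrix_inv H\<close> is a genuine inverse, and \<open>v\<close> is the
  gradient of the cost.\<close>

theorem theorem3:
  fixes u :: "(real^'m) list" and y :: "(real^'p) list" and Nd :: nat
    and Hu :: "(('ti::{finite,linorder} + 'n::{finite,linorder}) \<times> 'm, 't::{finite,linorder}) rmat"
    and Hy :: "(('ti + 'n) \<times> 'p, 't) rmat"
    and Up :: "('ti \<times> 'm, 't) rmat" and Uf :: "('n \<times> 'm, 't) rmat"
    and Yp :: "('ti \<times> 'p, 't) rmat" and Yf :: "('n \<times> 'p, 't) rmat"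
    and uini :: "('ti \<times> 'm) rvec" and yini :: "('ti \<times> 'p) rvec" and yref :: "('n \<times> 'p) rvec"
    and Q :: "('n \<times> 'p, 'n \<times> 'p) rmat" and R :: "('n \<times> 'm, 'n \<times> 'm) rmat"
    and lg ly lu :: real
    and J f :: "'t rvec \<Rightarrow> 't rvec \<Rightarrow> real"
    and gmin :: "'t rvec \<Rightarrow> 't rvec"
    and M H :: "('t, 't) rmat" and gs v p :: "'t rvec" and j :: 't
  assumes "length u = Nd" and "length y = Nd"
    and "CARD('ti) + CARD('n) \<le> Nd"
    and "CARD('t) = Nd - (CARD('ti) + CARD('n)) + 1"
    and "Hu = hankel u" and "Hy = hankel y"
    and "Up = past_rows Hu" and "Uf = future_rows Hu"
    and "Yp = past_rows Hy" and "Yf = future_rows Hy"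
    and "sym_pos_def Q" and "sym_pos_def R"
    and "lg > 0" and "ly > 0" and "lu > 0"
    and "J = deepc_objective Q R lg ly lu Up Uf Yp Yf uini yini yref"
    and "f = control_cost Q R Yf Uf yref"
    and "gmin = (\<lambda>w. THE g. is_arg_min (\<lambda>g'. J g' w) (\<lambda>_. True) g)"
    and "gs = gmin 1"
    and "M = transpose Yf ** Q ** Yf + transpose Uf ** R ** Uf
             + ly *\<^sub>R (transpose Yp ** Yp) + lu *\<^sub>R (transpose Up ** Up)"
    and "H = M + lg *\<^sub>R mat 1"
    and "v = 2 *\<^sub>R (transpose Yf *v (Q *v (Yf *v gs - yref)) + transpose Uf *v (R *v (Uf *v gs)))"
    and "p = matrix_inv H *v v"
  shows "(\<forall>w. \<exists>!g. is_arg_min (\<lambda>g'. J g' w) (\<lambda>_. True) g)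
       \<and> invertible H
       \<and> (GDERIV (\<lambda>g. f g 1) gs :> v)
       \<and> ((\<lambda>s. let w = (\<chi> i. if i = j then s else 1) in f (gmin w) w)
            has_real_derivative 2 * lg * gs $ j * p $ j) (at 1)"
proof -
  note data = \<open>sym_pos_def Q\<close> \<open>sym_pos_def R\<close> \<open>lg > 0\<close> \<open>ly > 0\<close> \<open>lu > 0\<close>
  note J = \<open>J = deepc_objective Q R lg ly lu Up Uf Yp Yf uini yini yref\<close>
  note f = \<open>f = control_cost Q R Yf Uf yref\<close>
  note M = \<open>M = _\<close> and H = \<open>H = _\<close> and v = \<open>v = _\<close>
  have ex1: "\<exists>!g. is_arg_min (\<lambda>g'. J g' w) (\<lambda>_. True) g" for w
    unfolding J by (rule ex1_is_arg_min_deepc[OF data])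
  have "is_arg_min (\<lambda>g'. J g' w) (\<lambda>_. True) (gmin w)" for w
    unfolding \<open>gmin = _\<close> by (rule theI'[OF ex1])
  \<comment> \<open>Minimality becomes the normal equation, the form in which
    \<open>control_cost_sensitivity\<close> takes it.\<close>
  note gmin = this[unfolded J is_arg_min_deepc_iff[OF data]]
  have "invertible H"
    unfolding H M by (rule sym_pos_def_imp_invertible[OF sym_pos_def_hessian[OF data]])
  moreover have "GDERIV (\<lambda>g. f g 1) gs :> v"
    unfolding f v by (rule gderiv_control_cost[OF data(1,2)])
  moreover have "((\<lambda>s. let w = (\<chi> i. if i = j then s else 1) in f (gmin w) w)
      has_real_derivative 2 * lg * gs $ j * p $ j) (at 1)"
    unfolding f \<open>p = _\<close> v H M \<open>gs = _\<close> by (rule control_cost_sensitivity[OF data gmin])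
  ultimately show ?thesis
    using ex1 by blast
qed

end
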